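(* There is an absolute constant $C>0$ such that for every prime $q$ and every $0<R<\frac12$, \[\left|\mathrm{Var}(\mu_q;B_R)-\frac{\mathrm{vol}(B_R)}{\varphi(q)}\right|\le C\,R^4(\log q)^2.\]
   Context: $\mathbb{T}^2=(\mathbb{R}/\mathbb{Z})^2$ carries the flat metric induced from $\mathbb{R}^2$ and Lebesgue (Haar) probability measure $\mathrm{vol}$ (written $dx$). For $x\in\mathbb{T}^2$ and $0<R<\frac12$, $B_R(x)$ is the geodesic ball of radius $R$ centred at $x$, and $\mathrm{vol}(B_R)=\pi R^2$. For a positive integer $q$, $\varphi(q)=\#(\mathbb{Z}/q\mathbb{Z})^\times$, and $\overline{d}$ denotes the inverse of $d\in(\mathbb{Z}/q\mathbb{Z})^\times$ modulo $q$. The probability measure $\mu_q$ on $\mathbb{T}^2$ is $\mu_q(B)=\frac{1}{\varphi(q)}\#\{d\in(\mathbb{Z}/q\mathbb{Z})^\times:(d/q,\overline{d}/q)\in B\}$. The variance is $\mathrm{Var}(\mu_q;B_R)=\int_{\mathbb{T}^2}\left(\mu_q(B_R(x))-\mathrm{vol}(B_R)\right)^2dx$. *)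

theory Defs
  imports "HOL-Probability.Probability" "HOL-Number_Theory.Number_Theory"
begin

quotient_type circle = real / "\<lambda>x y. x - y \<in> \<int>"
  morphisms rep_circle circ
proof (rule equivpI)
  show "reflp (\<lambda>x y::real. x - y \<in> \<int>)"
    by (simp add: reflp_def)
  show "symp (\<lambda>x y::real. x - y \<in> \<int>)"
    unfolding symp_def by (metis Ints_minus minus_diff_eq)
  show "transp (\<lambda>x y::real. x - y \<in> \<int>)"
    unfolding transp_def by (metis Ints_add diff_add_cancel add_diff_eq)
qed

lemma infdist_Ints_attained:
  fixes x :: real
  obtains k where "k \<in> \<int>" "infdist x \<int> = dist x k"
  using infdist_attains_inf[of "\<int> :: real set" x] closed_Ints Ints_0 by blast

lemma infdist_Ints_shift:
  fixes x a :: real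
  assumes "a \<in> \<int>"
  shows "infdist (x + a) \<int> = infdist x \<int>"
proof -
  have le: "infdist (z + b) \<int> \<le> infdist z \<int>" if b: "b \<in> \<int>" for z b :: real
  proof -
    obtain k where k: "k \<in> \<int>" "infdist z \<int> = dist z k"
      by (rule infdist_Ints_attained)
    have "infdist (z + b) \<int> \<le> dist (z + b) (k + b)"
      using k b by (intro infdist_le) auto
    with k show ?thesis by simp
  qed
  show ?thesis
    using le[OF assms, of x] le[of "-a" "x + a"] assms by simp
qed

lemma infdist_Ints_minus:
  fixes x :: real
  shows "infdist (-x) \<int> = infdist x \<int>"
proof -
  have le: "infdist (-z) \<int> \<le> infdist z \<int>" for z :: real
  proof -
    obtain k where k: "k \<in> \<int>" "infdist z \<int> = dist z k"
      by (rule infdist_Ints_attained)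
    have "infdist (-z) \<int> \<le> dist (-z) (-k)"
      using k by (intro infdist_le) auto
    with k show ?thesis by (simp add: dist_minus)
  qed
  show ?thesis
    using le[of x] le[of "-x"] by simp
qed

lemma infdist_Ints_triangle:
  fixes x y :: real
  shows "infdist (x + y) \<int> \<le> infdist x \<int> + infdist y \<int>"
proof -
  obtain k where k: "k \<in> \<int>" "infdist x \<int> = dist x k"
    by (rule infdist_Ints_attained)
  obtain l where l: "l \<in> \<int>" "infdist y \<int> = dist y l"
    by (rule infdist_Ints_attained)
  have "infdist (x + y) \<int> \<le> dist (x + y) (k + l)"
    using k l by (intro infdist_le) auto
  also have "\<dots> \<le> dist x k + dist y l"
    by (rule dist_triangle_add)
  finally show ?thesis using k l by simp
qed

instantiation circle :: metric_space
begin

lift_definition dist_circle :: "circle \<Rightarrow> circle \<Rightarrow> real"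
  is "\<lambda>x y. infdist (x - y) \<int>"
proof -
  fix x x' y y' :: real
  assume "x - x' \<in> \<int>" "y - y' \<in> \<int>"
  then show "infdist (x - y) \<int> = infdist (x' - y') \<int>"
    using infdist_Ints_shift[of "(x - x') - (y - y')" "x' - y'"] by simp
qed

definition uniformity_circle :: "(circle \<times> circle) filter"
  where "uniformity_circle = (INF e\<in>{0 <..}. principal {(x, y). dist x y < e})"

definition open_circle :: "circle set \<Rightarrow> bool"
  where "open_circle U \<longleftrightarrow> (\<forall>x\<in>U. eventually (\<lambda>(x', y). x' = x \<longrightarrow> y \<in> U) uniformity)"

instance
proof
  show "dist x y = 0 \<longleftrightarrow> x = y" for x y :: circle
    by transfer (use in_closed_iff_infdist_zero[of "\<int> :: real set"] closed_Ints in auto)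
  show "dist x y \<le> dist x z + dist y z" for x y z :: circle
  proof transfer
    fix x y z :: real
    show "infdist (x - y) \<int> \<le> infdist (x - z) \<int> + infdist (y - z) \<int>"
      using infdist_Ints_triangle[of "x - z" "-(y - z)"] by (simp add: infdist_Ints_minus[symmetric, of "y - z"])
  qed
qed (fact uniformity_circle_def open_circle_def)+

end

text \<open>
  The torus is \<open>circle \<times> circle\<close>. The library distance on a product is
  the Euclidean combination of the distances of the components, that is, the flat metric;
  lemma \<open>dist_torus_proj\<close> identifies it with the quotient metric from the plane. Hence
  \<open>ball x R\<close> is the (open) geodesic ball.
\<close>

type_synonym torus = "circle \<times> circle"

definition torus_proj :: "real \<times> real \<Rightarrow> torus"
  where "torus_proj p = (circ (fst p), circ (snd p))"

lemma dist_circ: "dist (circ x) (circ y) = infdist (x - y) \<int>"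
  by (simp add: dist_circle.abs_eq)

lemma dist_torus_proj:
  "dist (torus_proj u) (torus_proj v) = (INF k\<in>\<int> \<times> \<int>. dist u (v + k))"
proof (rule antisym)
  show "dist (torus_proj u) (torus_proj v) \<le> (INF k\<in>\<int> \<times> \<int>. dist u (v + k))"
  proof (rule cINF_greatest)
    fix k :: "real \<times> real"
    assume k: "k \<in> \<int> \<times> \<int>"
    have "infdist (fst u - fst v) \<int> \<le> dist (fst u - fst v) (fst k)"
         "infdist (snd u - snd v) \<int> \<le> dist (snd u - snd v) (snd k)"
      using k by (auto intro!: infdist_le)
    then have "infdist (fst u - fst v) \<int> \<le> dist (fst u) (fst v + fst k)"
         "infdist (snd u - snd v) \<int> \<le> dist (snd u) (snd v + snd k)"
      by (simp_all add: dist_real_def algebra_simps)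
    then show "dist (torus_proj u) (torus_proj v) \<le> dist u (v + k)"
      by (auto simp: dist_prod_def torus_proj_def dist_circ infdist_nonneg
          intro!: real_sqrt_le_mono add_mono power_mono)
  qed (use Ints_0 in blast)
next
  obtain k where k: "k \<in> \<int>" "infdist (fst u - fst v) \<int> = dist (fst u - fst v) k"
    by (rule infdist_Ints_attained)
  obtain l where l: "l \<in> \<int>" "infdist (snd u - snd v) \<int> = dist (snd u - snd v) l"
    by (rule infdist_Ints_attained)
  have "(INF k\<in>\<int> \<times> \<int>. dist u (v + k)) \<le> dist u (v + (k, l))"
    using k l by (intro cINF_lower) (auto intro!: bdd_belowI[of _ 0])
  also have "\<dots> = dist (torus_proj u) (torus_proj v)"
    using k l by (simp add: dist_prod_def torus_proj_def dist_circ dist_real_def algebra_simps)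
  finally show "(INF k\<in>\<int> \<times> \<int>. dist u (v + k)) \<le> dist (torus_proj u) (torus_proj v)" .
qed

text \<open>Haar probability measure, obtained from Lebesgue measure on a fundamental domain.\<close>

definition torus_measure :: "torus measure"
  where "torus_measure =
    distr (restrict_space lborel ({0..<1} \<times> {0..<1})) borel torus_proj"

lemma continuous_on_torus_proj: "continuous_on A torus_proj"
proof (rule continuous_on_subset)
  have "dist (torus_proj u) (torus_proj v) \<le> dist u v" for u v
    unfolding dist_torus_proj
    by (rule cINF_lower2[where x = 0]) (auto intro!: bdd_belowI[of _ 0] simp: mem_Times_iff)
  then show "continuous_on UNIV torus_proj"
    unfolding continuous_on_iff by (meson le_less_trans)
qed simp

lemma prob_space_torus_measure: "prob_space torus_measure"
  unfolding torus_measure_def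
proof (rule prob_space.prob_space_distr)
  have "{0..<1::real} \<times> {0..<1::real} \<in> sets (borel \<Otimes>\<^sub>M borel)"
    by (intro pair_measureI) auto
  then have S: "{0..<1::real} \<times> {0..<1::real} \<in> sets lborel"
    by (simp only: borel_prod sets_lborel)
  have "emeasure lborel ({0..<1::real} \<times> {0..<1::real}) = 1"
    unfolding lborel_prod[symmetric]
    by (subst lborel.emeasure_pair_measure_Times) auto
  then show "prob_space (restrict_space lborel ({0..<1::real} \<times> {0..<1::real}))"
    using S by (intro prob_spaceI) (simp add: emeasure_restrict_space space_restrict_space)
  show "torus_proj \<in> borel_measurable (restrict_space lborel ({0..<1} \<times> {0..<1}))"
    by (intro measurable_restrict_space1)
      (simp add: borel_measurable_continuous_onI continuous_on_torus_proj)
qed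

text \<open>The measure is translation invariant, so the choice of centre is immaterial.\<close>

definition torus_ball_vol :: "real \<Rightarrow> real"
  where "torus_ball_vol R = measure torus_measure (ball (torus_proj (0, 0)) R)"

text \<open>The residues coprime to \<open>q\<close> are represented by \<open>totatives q\<close>.\<close>

definition mu :: "nat \<Rightarrow> torus set \<Rightarrow> real"
  where "mu q B =
    real (card {d \<in> totatives q.
      torus_proj (real d / real q,
        real_of_int (modular_inverse (int q) (int d)) / real q) \<in> B}) / real (totient q)"

definition Var_mu :: "nat \<Rightarrow> real \<Rightarrow> real"
  where "Var_mu q R = (LINT x|torus_measure. (mu q (ball x R) - torus_ball_vol R)\<^sup>2)"

end

theory Submission
  imports Defs
begin

text \<open>
  Expanding the square, and using that all balls of radius \<open>R\<close> have the same volume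
  \<open>v\<close>, the variance equals \<open>v / \<phi>(q) - v\<^sup>2\<close> plus
  \<open>1 / \<phi>(q)\<^sup>2\<close> times the sum of \<open>vol (B\<^sub>d \<inter> B\<^sub>e)\<close> over pairs
  \<open>d \<noteq> e\<close>. Only pairs of points at distance less than \<open>2 R\<close> contribute, each at most
  \<open>v \<le> 4 R\<^sup>2\<close>. For such a pair, \<open>e = d + a\<close> and \<open>e\<^sup>-\<^sup>1 = d\<^sup>-\<^sup>1 + b\<close>
  modulo \<open>q\<close> with nonzero \<open>a\<close> and \<open>b\<close> of size less than \<open>2 R q\<close>, and eliminating
  \<open>e\<close> gives \<open>b d\<^sup>2 + a b d + a = 0\<close> modulo \<open>q\<close>, which has at most two solutions
  \<open>d\<close>. So there are \<open>O(R\<^sup>2 q\<^sup>2)\<close> pairs and the error is \<open>O(R\<^sup>4)\<close>, while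
  \<open>(ln q)\<^sup>2 \<ge> 1 / 4\<close>.
\<close>

section \<open>Integrals of periodic functions and translation invariance of the torus
  measure\<close>

lemma nn_integral_lborel_shift:
  fixes f :: "real \<Rightarrow> ennreal"
  assumes [measurable]: "f \<in> borel_measurable borel"
  shows "(\<integral>\<^sup>+x. f (x + c) \<partial>lborel) = (\<integral>\<^sup>+x. f x \<partial>lborel)"
  using nn_integral_real_affine[of f 1 c] by (simp add: add.commute)

text \<open>Periodicity replaces \<open>c\<close> by its fractional part \<open>t\<close>. The
  window from \<open>t\<close> to \<open>1 + t\<close> is then cut at 1, and the part beyond 1 moves
  back by one period to fill the gap from 0 to \<open>t\<close>.\<close>

lemma nn_integral_periodic_shift:
  fixes f :: "real \<Rightarrow> ennreal"
  assumes [measurable]: "f \<in> borel_measurable borel"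
    and per: "\<And>x k. k \<in> \<int> \<Longrightarrow> f (x + k) = f x"
  shows "(\<integral>\<^sup>+x\<in>{0..<1}. f (x + c) \<partial>lborel) = (\<integral>\<^sup>+x\<in>{0..<1}. f x \<partial>lborel)"
proof -
  define t where "t = frac c"
  have t: "0 \<le> t" "t < 1" by (auto simp: t_def frac_lt_1)
  have c: "f (x + c) = f (x + t)" for x
    using per[of "of_int \<lfloor>c\<rfloor>" "x + t"] by (simp add: t_def frac_def)
  have "(\<integral>\<^sup>+x\<in>{0..<1}. f (x + c) \<partial>lborel) = (\<integral>\<^sup>+x. f (x + t) * indicator {t..<1+t} (x + t) \<partial>lborel)"
    by (intro nn_integral_cong) (auto simp: c split: split_indicator)
  also have "\<dots> = (\<integral>\<^sup>+x. f x * indicator {t..<1+t} x \<partial>lborel)"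
    by (rule nn_integral_lborel_shift[of "\<lambda>x. f x * indicator {t..<1+t} x"]) measurable
  also have "\<dots> = (\<integral>\<^sup>+x. f x * indicator {t..<1} x + f x * indicator {1..<1+t} x \<partial>lborel)"
    using t by (intro nn_integral_cong) (auto split: split_indicator)
  also have "\<dots> = (\<integral>\<^sup>+x. f x * indicator {t..<1} x \<partial>lborel) + (\<integral>\<^sup>+x. f x * indicator {1..<1+t} x \<partial>lborel)"
    by (rule nn_integral_add) measurable
  also have "(\<integral>\<^sup>+x. f x * indicator {1..<1+t} x \<partial>lborel)
      = (\<integral>\<^sup>+x. f (x + 1) * indicator {1..<1+t} (x + 1) \<partial>lborel)"
    by (rule nn_integral_lborel_shift[of "\<lambda>x. f x * indicator {1..<1+t} x", symmetric]) measurable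
  also have "\<dots> = (\<integral>\<^sup>+x. f x * indicator {0..<t} x \<partial>lborel)"
    by (intro nn_integral_cong) (auto simp: per split: split_indicator)
  also have "(\<integral>\<^sup>+x. f x * indicator {t..<1} x \<partial>lborel) + (\<integral>\<^sup>+x. f x * indicator {0..<t} x \<partial>lborel)
     = (\<integral>\<^sup>+x. f x * indicator {t..<1} x + f x * indicator {0..<t} x \<partial>lborel)"
    by (rule nn_integral_add[symmetric]) measurable
  also have "\<dots> = (\<integral>\<^sup>+x\<in>{0..<1}. f x \<partial>lborel)"
    using t by (intro nn_integral_cong) (auto split: split_indicator)
  finally show ?thesis .
qed

lemma sets_torus_measure [measurable_cong, simp]: "sets torus_measure = sets borel"
  by (simp add: torus_measure_def)

lemma measurable_torus_proj [measurable]: "torus_proj \<in> borel_measurable borel"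
  by (simp add: borel_measurable_continuous_onI continuous_on_torus_proj)

text \<open>Tonelli on the fundamental domain. The iterated form allows a translation to be treated
  one coordinate at a time.\<close>

lemma emeasure_torus_measure:
  assumes U: "U \<in> sets borel"
  shows "emeasure torus_measure U =
    (\<integral>\<^sup>+x\<in>{0..<1}. (\<integral>\<^sup>+y\<in>{0..<1}. indicator U (torus_proj (x, y)) \<partial>lborel) \<partial>lborel)"
proof -
  let ?S = "{0..<1::real} \<times> {0..<1::real}"
  have "?S \<in> sets (borel \<Otimes>\<^sub>M borel)"
    by (intro pair_measureI) auto
  then have S: "?S \<in> sets borel"
    by (simp only: borel_prod)
  have P: "torus_proj -` U \<in> sets borel"
    using measurable_sets[OF measurable_torus_proj U] by simp
  then have PS: "torus_proj -` U \<inter> ?S \<in> sets borel"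
    using S by blast
  have "emeasure torus_measure U = emeasure lborel (torus_proj -` U \<inter> ?S)"
    unfolding torus_measure_def using U S
    by (subst emeasure_distr)
      (auto simp: measurable_restrict_space1 space_restrict_space emeasure_restrict_space)
  also have "\<dots> = emeasure (lborel \<Otimes>\<^sub>M lborel) (torus_proj -` U \<inter> ?S)"
    by (simp add: lborel_prod)
  also have "\<dots> = (\<integral>\<^sup>+x. \<integral>\<^sup>+y. indicator (torus_proj -` U \<inter> ?S) (x, y) \<partial>lborel \<partial>lborel)"
    by (rule lborel.emeasure_pair_measure) (use PS in \<open>simp only: lborel_prod sets_lborel\<close>)
  also have "\<dots> = (\<integral>\<^sup>+x\<in>{0..<1}. (\<integral>\<^sup>+y\<in>{0..<1}. indicator U (torus_proj (x, y)) \<partial>lborel) \<partial>lborel)"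
    by (auto intro!: nn_integral_cong split: split_indicator)
  finally show ?thesis .
qed

lemma torus_proj_in_ball_shift:
  "torus_proj p \<in> ball (torus_proj (c + d)) R \<longleftrightarrow> torus_proj (p - d) \<in> ball (torus_proj c) R"
  by (simp add: torus_proj_def dist_prod_def dist_circ algebra_simps)

lemma circ_add_Ints: "k \<in> \<int> \<Longrightarrow> circ (x + k) = circ x"
  using circle.abs_eq_iff by simp

text \<open>Moving the centre to the origin shifts both coordinates of the integrand
  \<open>g\<close>, which has period 1 in each. The inner shift is removed first, then the outer
  one.\<close>

lemma measure_torus_ball: "measure torus_measure (ball (torus_proj c) R) = torus_ball_vol R"
proof -
  define g :: "real \<Rightarrow> real \<Rightarrow> ennreal"
    where "g x y = indicator (ball (torus_proj (0, 0)) R) (torus_proj (x, y))" for x y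
  obtain a b where c: "c = (a, b)" by fastforce
  have ind: "indicator (ball (torus_proj c) R) (torus_proj (x, y)) = g (x + - a) (y + - b)" for x y
    using torus_proj_in_ball_shift[of "(x, y)" "(0, 0)" c R]
    by (simp add: c g_def indicator_def del: mem_ball)
  have per: "g (x + k) y = g x y" "g x (y + k) = g x y" if "k \<in> \<int>" for x y k
    using that by (simp_all add: g_def torus_proj_def circ_add_Ints)
  have [measurable]: "torus_proj \<in> borel \<Otimes>\<^sub>M borel \<rightarrow>\<^sub>M borel"
    by (simp add: borel_prod)
  have [measurable]: "ball (torus_proj (0, 0)) R \<in> sets borel" by simp
  \<comment> \<open>Joint measurability makes the inner integral measurable in \<open>x\<close>, as
    the outer shift requires.\<close>
  have [measurable]: "(\<lambda>(x, y). g x y) \<in> borel_measurable (borel \<Otimes>\<^sub>M borel)"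
    unfolding g_def split_beta' prod.collapse by measurable
  have "emeasure torus_measure (ball (torus_proj c) R) =
      (\<integral>\<^sup>+x\<in>{0..<1}. (\<integral>\<^sup>+y\<in>{0..<1}. g (x + - a) (y + - b) \<partial>lborel) \<partial>lborel)"
    by (simp add: emeasure_torus_measure ind)
  also have "\<dots> = (\<integral>\<^sup>+x\<in>{0..<1}. (\<integral>\<^sup>+y\<in>{0..<1}. g (x + - a) y \<partial>lborel) \<partial>lborel)"
    by (subst nn_integral_periodic_shift) (auto simp: per)
  also have "\<dots> = (\<integral>\<^sup>+x\<in>{0..<1}. (\<integral>\<^sup>+y\<in>{0..<1}. g x y \<partial>lborel) \<partial>lborel)"
    by (rule nn_integral_periodic_shift[of "\<lambda>x. \<integral>\<^sup>+y\<in>{0..<1}. g x y \<partial>lborel"])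
      (auto simp: per)
  also have "\<dots> = emeasure torus_measure (ball (torus_proj (0, 0)) R)"
    by (simp add: emeasure_torus_measure g_def)
  finally show ?thesis
    by (simp add: torus_ball_vol_def measure_def)
qed

section \<open>Ball volumes and the second moment of an average of indicators\<close>

lemma infdist_Ints_less_imp_near_endpoint:
  fixes x :: real
  assumes "infdist x \<int> < r" "0 \<le> x" "x < 1"
  shows "x < r \<or> 1 - r < x"
proof -
  obtain k where k: "k \<in> \<int>" "infdist x \<int> = dist x k" by (rule infdist_Ints_attained)
  then obtain n where n: "k = of_int n" by (auto elim: Ints_cases)
  consider "n \<le> 0" | "n \<ge> 1" by linarith
  then show ?thesis
  proof cases
    case 1
    then have "k \<le> 0" by (simp add: n)
    then show ?thesis using assms k by (simp add: dist_real_def)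
  next
    case 2
    then have "k \<ge> 1" by (simp add: n)
    then show ?thesis using assms k by (simp add: dist_real_def)
  qed
qed

text \<open>The ball lies in the square of side \<open>2 * R\<close> with the same centre, wrapped
  around the corners of the fundamental domain.\<close>

lemma torus_ball_vol_le:
  assumes "0 \<le> R"
  shows "torus_ball_vol R \<le> 4 * R\<^sup>2"
proof -
  \<comment> \<open>Coordinates in [0, 1) at distance less than \<open>R\<close> from the integers
    lie here. The pieces overlap for large \<open>R\<close>, so the length is bounded by
    subadditivity.\<close>
  define A where "A = {0..R} \<union> {1 - R..1}"
  have [measurable]: "A \<in> sets borel" by (simp add: A_def)
  have A: "emeasure lborel A \<le> ennreal (2 * R)"
  proof -
    have "emeasure lborel A \<le> emeasure lborel {0..R} + emeasure lborel {1 - R..1}"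
      unfolding A_def by (rule emeasure_subadditive) auto
    also have "\<dots> = ennreal (2 * R)"
      using assms by (simp flip: ennreal_plus)
    finally show ?thesis .
  qed
  have "emeasure torus_measure (ball (torus_proj (0, 0)) R) \<le>
      (\<integral>\<^sup>+x. (\<integral>\<^sup>+y. indicator A x * indicator A y \<partial>lborel) \<partial>lborel)"
  proof (subst emeasure_torus_measure, simp, intro nn_integral_mono)
    fix x :: real
    have "indicator (ball (torus_proj (0, 0)) R) (torus_proj (x, y)) * indicator {0..<1} y
        \<le> (indicator A x * indicator A y :: ennreal)" if x: "x \<in> {0..<1}" for y
    proof (cases "y \<in> {0..<1} \<and> torus_proj (x, y) \<in> ball (torus_proj (0, 0)) R")
      case True
      then have *: "sqrt ((infdist (- x) \<int>)\<^sup>2 + (infdist (- y) \<int>)\<^sup>2) < R"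
        by (simp add: dist_prod_def torus_proj_def dist_circ)
      have "infdist x \<int> < R" "infdist y \<int> < R"
        using le_less_trans[OF real_sqrt_sum_squares_ge1 *] le_less_trans[OF real_sqrt_sum_squares_ge2 *]
        by (simp_all add: infdist_Ints_minus)
      then have "x \<in> A" "y \<in> A"
        using infdist_Ints_less_imp_near_endpoint[of x R] infdist_Ints_less_imp_near_endpoint[of y R] True x by (auto simp: A_def)
      then show ?thesis by (simp split: split_indicator)
    qed (auto split: split_indicator)
    then show "(\<integral>\<^sup>+y\<in>{0..<1}. indicator (ball (torus_proj (0, 0)) R) (torus_proj (x, y)) \<partial>lborel)
        * indicator {0..<1} x \<le> (\<integral>\<^sup>+y. indicator A x * indicator A y \<partial>lborel)"
      by (cases "x \<in> {0..<1}") (auto intro!: nn_integral_mono simp del: mem_ball)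
  qed
  also have "\<dots> = emeasure lborel A * emeasure lborel A"
    by (simp add: nn_integral_cmult nn_integral_multc)
  also have "\<dots> \<le> ennreal (2 * R) * ennreal (2 * R)"
    by (intro mult_mono A) auto
  also have "\<dots> = ennreal (4 * R\<^sup>2)"
    using assms by (simp add: ennreal_mult[symmetric] power2_eq_square)
  finally show ?thesis
    unfolding torus_ball_vol_def measure_def
    using assms by (simp add: enn2real_leI)
qed

text \<open>Expand the square, a product of indicators being the indicator of the intersection. The
  diagonal pairs give \<open>v / card T\<close>, the cross term and the constant give
  \<open>- 2 * v\<^sup>2 + v\<^sup>2\<close>, and the off-diagonal pairs are kept exact for the
  later count.\<close>

lemma (in prob_space) second_moment_indicator_average:
  assumes T: "finite T" "T \<noteq> {}"
    and B: "\<And>d. d \<in> T \<Longrightarrow> B d \<in> events" "\<And>d. d \<in> T \<Longrightarrow> prob (B d) = v"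
  shows "expectation (\<lambda>x. ((\<Sum>d\<in>T. indicator (B d) x) / real (card T) - v)\<^sup>2) =
    v / card T - v\<^sup>2 + (\<Sum>(d, e)\<in>{p \<in> T \<times> T. fst p \<noteq> snd p}. prob (B d \<inter> B e)) / (real (card T))\<^sup>2"
proof -
  let ?N = "real (card T)" and ?f = "\<lambda>d x. indicator (B d) x :: real"
  have N: "?N > 0" using T by (simp add: card_gt_0_iff)
  have hb: "has_bochner_integral M (\<lambda>x. indicator A x :: real) (prob A)" if "A \<in> events" for A
    using that by (intro has_bochner_integral_real_indicator) (auto simp: less_top[symmetric])
  have "((\<Sum>d\<in>T. ?f d x) / ?N - v)\<^sup>2 =
      (\<Sum>d\<in>T. \<Sum>e\<in>T. indicator (B d \<inter> B e) x) / ?N\<^sup>2 - 2 * v / ?N * (\<Sum>d\<in>T. ?f d x) + v\<^sup>2" for x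
    by (simp add: power2_diff power_divide power2_eq_square[of "\<Sum>d\<in>T. ?f d x"] sum_product
        indicator_inter_arith)
  then have "expectation (\<lambda>x. ((\<Sum>d\<in>T. ?f d x) / ?N - v)\<^sup>2) =
      expectation (\<lambda>x. (\<Sum>d\<in>T. \<Sum>e\<in>T. indicator (B d \<inter> B e) x) / ?N\<^sup>2
        - 2 * v / ?N * (\<Sum>d\<in>T. ?f d x) + v\<^sup>2)"
    by simp
  also have "\<dots> = (\<Sum>d\<in>T. \<Sum>e\<in>T. prob (B d \<inter> B e)) / ?N\<^sup>2 - 2 * v / ?N * (\<Sum>d\<in>T. prob (B d)) + v\<^sup>2"
    using B has_bochner_integral_integrable[of M "\<lambda>_. v\<^sup>2"]
    by (intro has_bochner_integral_integral_eq has_bochner_integral_add has_bochner_integral_diff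
        has_bochner_integral_divide_zero has_bochner_integral_mult_right has_bochner_integral_sum hb)
      (auto simp: prob_space)
  also have "(\<Sum>d\<in>T. prob (B d)) = ?N * v"
    using B by simp
  also have "(\<Sum>d\<in>T. \<Sum>e\<in>T. prob (B d \<inter> B e)) = (\<Sum>(d, e)\<in>T \<times> T. prob (B d \<inter> B e))"
    using T by (simp add: sum.cartesian_product)
  also have "\<dots> = (\<Sum>(d, e)\<in>{p \<in> T \<times> T. fst p = snd p}. prob (B d \<inter> B e))
      + (\<Sum>(d, e)\<in>{p \<in> T \<times> T. fst p \<noteq> snd p}. prob (B d \<inter> B e))"
    using T by (subst sum.union_disjoint[symmetric]) (auto intro!: sum.cong)
  also have "{p \<in> T \<times> T. fst p = snd p} = (\<lambda>d. (d, d)) ` T"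
    by auto
  also have "(\<Sum>(d, e)\<in>(\<lambda>d. (d, d)) ` T. prob (B d \<inter> B e)) = ?N * v"
    using B by (subst sum.reindex) (auto simp: inj_on_def)
  also have "(?N * v + (\<Sum>(d, e)\<in>{p \<in> T \<times> T. fst p \<noteq> snd p}. prob (B d \<inter> B e))) / ?N\<^sup>2
        - 2 * v / ?N * (?N * v) + v\<^sup>2 =
      v / ?N - v\<^sup>2 + (\<Sum>(d, e)\<in>{p \<in> T \<times> T. fst p \<noteq> snd p}. prob (B d \<inter> B e)) / ?N\<^sup>2"
    using N by (simp add: field_simps power2_eq_square)
  finally show ?thesis .
qed

section \<open>Quadratic congruences and small representatives of residue classes\<close>

text \<open>The middle coefficient is \<open>a\<close> times the leading one, which is a unit modulo
  the prime \<open>q\<close>. By Vieta two distinct roots therefore sum to \<open>- a\<close>, so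
  one root \<open>d\<close> leaves a single other candidate.\<close>

lemma card_quadratic_roots_le:
  fixes a b :: int
  assumes q: "prime q" and b: "\<not> int q dvd b"
  shows "card {d \<in> {..<q}. int q dvd b * (int d)\<^sup>2 + a * b * int d + a} \<le> 2"
proof (cases "{d \<in> {..<q}. int q dvd b * (int d)\<^sup>2 + a * b * int d + a} = {}")
  case False
  then obtain d where d: "d < q" "int q dvd b * (int d)\<^sup>2 + a * b * int d + a" by auto
  have "e \<in> {d, nat ((- a - int d) mod int q)}"
    if e: "e < q" "int q dvd b * (int e)\<^sup>2 + a * b * int e + a" for e
  proof (cases "e = d")
    case False
    have "int q dvd (b * (int e)\<^sup>2 + a * b * int e + a) - (b * (int d)\<^sup>2 + a * b * int d + a)"
      using e d by (blast intro: dvd_diff)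
    also have "\<dots> = b * ((int e - int d) * (int e + int d + a))"
      by (simp add: algebra_simps power2_eq_square)
    finally have "int q dvd int e - int d \<or> int q dvd int e + int d + a"
      using q b by (simp add: prime_dvd_mult_iff)
    moreover have "\<not> int q dvd int e - int d"
      using False e d dvd_imp_le_int[of "int e - int d" "int q"] by auto
    ultimately have "int q dvd int e - (- a - int d)"
      by (simp add: algebra_simps)
    then have "int e mod int q = (- a - int d) mod int q"
      by (simp only: mod_eq_dvd_iff)
    then have "int e = (- a - int d) mod int q"
      using e by simp
    then show ?thesis
      by (metis insertCI nat_int)
  qed simp
  then have "{d \<in> {..<q}. int q dvd b * (int d)\<^sup>2 + a * b * int d + a} \<subseteq> {d, nat ((- a - int d) mod int q)}"
    by blast
  then have "card {d \<in> {..<q}. int q dvd b * (int d)\<^sup>2 + a * b * int d + a}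
      \<le> card {d, nat ((- a - int d) mod int q)}"
    by (rule card_mono[rotated]) simp
  also have "\<dots> \<le> 2"
    by (simp add: card_insert_if)
  finally show ?thesis .
next
  case True
  show ?thesis unfolding True by simp
qed

text \<open>If \<open>n\<close> is the integer nearest to \<open>m / q\<close>, scaling the distance
  by \<open>q\<close> gives the size of \<open>m - n * q\<close>. Closeness on the circle thus
  becomes smallness of an integer in the class of \<open>m\<close>.\<close>

lemma near_Ints_imp_small_residue:
  fixes m :: int
  assumes "infdist (of_int m / real q) \<int> < r" "q > 0"
  obtains a :: int where "\<bar>of_int a\<bar> < r * real q" "[a = m] (mod int q)"
proof -
  obtain k where k: "k \<in> \<int>" "infdist (of_int m / real q) \<int> = dist (of_int m / real q) k"
    by (rule infdist_Ints_attained)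
  then obtain n where n: "k = of_int n" by (auto elim: Ints_cases)
  have "\<bar>of_int m / real q - of_int n\<bar> * real q < r * real q"
    using assms k n by (simp add: dist_real_def)
  also have "\<bar>of_int m / real q - of_int n\<bar> * real q = \<bar>(of_int m / real q - of_int n) * real q\<bar>"
    by (simp add: abs_mult)
  also have "(of_int m / real q - of_int n) * real q = of_int (m - n * int q)"
    using assms by (simp add: field_simps)
  finally show ?thesis
    by (intro that[of "m - n * int q"]) (simp_all add: cong_iff_dvd_diff)
qed

text \<open>Excluding multiples of \<open>q\<close> removes 0 from a symmetric interval, which
  leaves at most \<open>2 * r\<close> integers rather than \<open>2 * r + 1\<close>. The missing 1
  matters: it keeps the later pair count quadratic in \<open>R\<close> even when
  \<open>R * q\<close> is small.\<close>

lemma card_small_nonresidues_le: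
  fixes r :: real
  assumes "r \<ge> 0"
  shows "finite {a::int. \<bar>of_int a\<bar> < r \<and> \<not> int q dvd a}"
    and "real (card {a::int. \<bar>of_int a\<bar> < r \<and> \<not> int q dvd a}) \<le> 2 * r"
proof -
  have sub: "{a::int. \<bar>of_int a\<bar> < r \<and> \<not> int q dvd a} \<subseteq> {-\<lfloor>r\<rfloor>..\<lfloor>r\<rfloor>} - {0}"
  proof
    fix a assume "a \<in> {a::int. \<bar>of_int a\<bar> < r \<and> \<not> int q dvd a}"
    then have "real_of_int \<bar>a\<bar> \<le> r" "a \<noteq> 0" by auto
    then have "\<bar>a\<bar> \<le> \<lfloor>r\<rfloor>" by (simp only: le_floor_iff)
    with \<open>a \<noteq> 0\<close> show "a \<in> {-\<lfloor>r\<rfloor>..\<lfloor>r\<rfloor>} - {0}" by auto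
  qed
  then show "finite {a::int. \<bar>of_int a\<bar> < r \<and> \<not> int q dvd a}"
    by (rule finite_subset) simp
  have "card {a::int. \<bar>of_int a\<bar> < r \<and> \<not> int q dvd a} \<le> card ({-\<lfloor>r\<rfloor>..\<lfloor>r\<rfloor>} - {0})"
    using sub by (rule card_mono[rotated]) simp
  also have "\<dots> = nat (2 * \<lfloor>r\<rfloor>)"
    using assms by (subst card_Diff_singleton) (auto simp: nat_diff_distrib')
  finally have "real (card {a::int. \<bar>of_int a\<bar> < r \<and> \<not> int q dvd a}) \<le> real (nat (2 * \<lfloor>r\<rfloor>))"
    by (simp only: of_nat_le_iff)
  also have "\<dots> \<le> 2 * r"
    using assms by simp
  finally show "real (card {a::int. \<bar>of_int a\<bar> < r \<and> \<not> int q dvd a}) \<le> 2 * r" .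
qed

section \<open>Counting pairs of nearby points\<close>

definition inverse_point :: "nat \<Rightarrow> nat \<Rightarrow> torus"
  where "inverse_point q d = torus_proj (real d / real q,
    real_of_int (modular_inverse (int q) (int d)) / real q)"

text \<open>For \<open>r = 2 * R\<close>, every off-diagonal pair left out has disjoint balls of
  radius \<open>R\<close>.\<close>

definition close_pairs :: "nat \<Rightarrow> real \<Rightarrow> (nat \<times> nat) set"
  where "close_pairs q r = {(d, e) \<in> totatives q \<times> totatives q.
    d \<noteq> e \<and> dist (inverse_point q d) (inverse_point q e) < r}"

text \<open>Here \<open>a\<close> and \<open>b\<close> are small representatives of the differences
  of the points and of their inverses. Since \<open>a\<close> and \<open>d\<close> determine
  \<open>e\<close>, the triple \<open>(a, b, d)\<close> encodes the pair.\<close>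

lemma close_pair_imp_quadratic_root:
  assumes q: "prime q" and de: "(d, e) \<in> close_pairs q r"
  obtains a b :: int where "\<bar>of_int a\<bar> < r * real q" "\<bar>of_int b\<bar> < r * real q"
    "\<not> int q dvd a" "\<not> int q dvd b" "int q dvd b * (int d)\<^sup>2 + a * b * int d + a"
    "e = nat ((int d + a) mod int q)" "d < q"
proof -
  define d' e' where "d' = modular_inverse (int q) (int d)" and "e' = modular_inverse (int q) (int e)"
  have q1: "q > 1" using q by (rule prime_gt_1_nat)
  have T: "d \<in> totatives q" "e \<in> totatives q" "d \<noteq> e"
    and dist: "dist (inverse_point q d) (inverse_point q e) < r"
    using de by (auto simp: close_pairs_def)
  have lt: "d < q" "e < q"
    using T q1 by (auto simp: totatives_less)
  have inv: "[int d * d' = 1] (mod int q)" "[int e * e' = 1] (mod int q)"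
    using T by (auto simp: d'_def e'_def totatives_def intro!: cong_modular_inverse1)
  have *: "sqrt ((infdist ((real d - real e) / q) \<int>)\<^sup>2 + (infdist ((of_int d' - of_int e') / q) \<int>)\<^sup>2) < r"
    using dist by (simp add: inverse_point_def dist_prod_def torus_proj_def dist_circ d'_def e'_def
        diff_divide_distrib)
  have 1: "infdist (of_int (int e - int d) / real q) \<int> < r"
    using le_less_trans[OF real_sqrt_sum_squares_ge1 *] infdist_Ints_minus[of "(real d - real e) / q"]
    by (simp add: minus_divide_left)
  have 2: "infdist (of_int (e' - d') / real q) \<int> < r"
    using le_less_trans[OF real_sqrt_sum_squares_ge2 *]
      infdist_Ints_minus[of "(of_int d' - of_int e') / real q"]
    by (simp add: minus_divide_left)
  obtain a where a: "\<bar>of_int a\<bar> < r * real q" "[a = int e - int d] (mod int q)"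
    by (rule near_Ints_imp_small_residue[OF 1]) (use q1 in auto)
  obtain b where b: "\<bar>of_int b\<bar> < r * real q" "[b = e' - d'] (mod int q)"
    by (rule near_Ints_imp_small_residue[OF 2]) (use q1 in auto)
  have ne: "\<not> [int d = int e] (mod int q)"
    using lt T(3) by (simp add: cong_int_iff cong_def)
  have "\<not> int q dvd a"
    using ne a(2) by (metis cong_0_iff cong_diff_iff_cong_0 cong_sym cong_trans)
  moreover have "\<not> int q dvd b"
  proof
    assume "int q dvd b"
    then have "[e' = d'] (mod int q)"
      using b(2) by (metis cong_0_iff cong_diff_iff_cong_0 cong_sym cong_trans)
    \<comment> \<open>Multiplying by \<open>d * e\<close> undoes both inverses, so equal inverses
      would force \<open>d\<close> and \<open>e\<close> to agree modulo \<open>q\<close>.\<close>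
    then have "[int d * (int e * e') = int e * (int d * d')] (mod int q)"
      using cong_scalar_left[of e' d' "int q" "int d * int e"] by (simp add: mult_ac)
    then have "[int d * 1 = int e * 1] (mod int q)"
      using inv by (meson cong_scalar_left cong_sym cong_trans)
    then show False using ne by simp
  qed
  moreover have "int q dvd b * (int d)\<^sup>2 + a * b * int d + a"
  proof -
    have "[(int d + a) * (d' + b) = int e * e'] (mod int q)"
    proof (rule cong_mult)
      show "[int d + a = int e] (mod int q)"
        using cong_add[OF cong_refl a(2), of "int d"] by simp
      show "[d' + b = e'] (mod int q)"
        using cong_add[OF cong_refl b(2), of "d'"] by simp
    qed
    then have "[int d * ((int d + a) * (d' + b)) = int d * 1] (mod int q)"
      using inv(2) by (meson cong_scalar_left cong_trans)
    then have "int q dvd int d * ((int d + a) * (d' + b)) - int d"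
      by (simp add: cong_iff_dvd_diff)
    moreover have "int q dvd (int d + a) * (int d * d' - 1)"
      using inv(1) by (simp add: cong_iff_dvd_diff)
    \<comment> \<open>Subtracting this multiple of \<open>int d * d' - 1\<close> eliminates
      \<open>d'\<close> and leaves a polynomial in \<open>d\<close> alone.\<close>
    ultimately have "int q dvd (int d * ((int d + a) * (d' + b)) - int d) - (int d + a) * (int d * d' - 1)"
      by (rule dvd_diff)
    also have "\<dots> = b * (int d)\<^sup>2 + a * b * int d + a"
      by (simp add: algebra_simps power2_eq_square)
    finally show ?thesis .
  qed
  moreover have "e = nat ((int d + a) mod int q)"
  proof -
    have "[int d + a = int e] (mod int q)"
      using cong_add[OF cong_refl a(2), of "int d"] by simp
    then show ?thesis using lt by (simp add: cong_def)
  qed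
  ultimately show ?thesis
    using that a(1) b(1) lt(1) by blast
qed

text \<open>There are at most \<open>2 * r * q\<close> choices for each of \<open>a\<close> and
  \<open>b\<close>, and then at most two for \<open>d\<close>. Covering the pairs by an image
  suffices, so a pair may arise from several triples.\<close>

lemma card_close_pairs_le:
  assumes q: "prime q" and r: "r \<ge> 0"
  shows "real (card (close_pairs q r)) \<le> 8 * (r * real q)\<^sup>2"
proof -
  define I where "I = {a::int. \<bar>of_int a\<bar> < r * real q \<and> \<not> int q dvd a}"
  define Z where "Z p = {d \<in> {..<q}. int q dvd snd p * (int d)\<^sup>2 + fst p * snd p * int d + fst p}"
    for p :: "int \<times> int"
  have I: "finite I" "real (card I) \<le> 2 * (r * real q)"
    unfolding I_def using r by (intro card_small_nonresidues_le; simp)+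
  have Z: "finite (Z p)" "p \<in> I \<times> I \<Longrightarrow> card (Z p) \<le> 2" for p
    using card_quadratic_roots_le[OF q, of "snd p" "fst p"] by (auto simp: Z_def I_def)
  have "close_pairs q r \<subseteq> (\<lambda>(p, d). (d, nat ((int d + fst p) mod int q))) ` Sigma (I \<times> I) Z"
  proof clarify
    fix d e assume "(d, e) \<in> close_pairs q r"
    then obtain a b :: int where "a \<in> I" "b \<in> I" "d \<in> Z (a, b)" "e = nat ((int d + a) mod int q)"
      by (rule close_pair_imp_quadratic_root[OF q]) (auto simp: I_def Z_def)
    then show "(d, e) \<in> (\<lambda>(p, d). (d, nat ((int d + fst p) mod int q))) ` Sigma (I \<times> I) Z"
      by (intro image_eqI[where x = "((a, b), d)"]) auto
  qed
  then have "card (close_pairs q r) \<le> card (Sigma (I \<times> I) Z)"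
    using I Z by (intro surj_card_le) auto
  also have "\<dots> = (\<Sum>p\<in>I \<times> I. card (Z p))"
    using I Z by simp
  also have "\<dots> \<le> (\<Sum>p\<in>I \<times> I. 2)"
    using Z by (intro sum_mono) auto
  also have "\<dots> = 2 * (card I)\<^sup>2"
    by (simp add: card_cartesian_product power2_eq_square)
  finally have "real (card (close_pairs q r)) \<le> 2 * (real (card I))\<^sup>2"
    by (metis of_nat_le_iff of_nat_mult of_nat_numeral of_nat_power)
  also have "\<dots> \<le> 2 * (2 * (r * real q))\<^sup>2"
    using I by (intro mult_left_mono power_mono) auto
  finally show ?thesis by (simp add: power_mult_distrib)
qed

section \<open>The variance as a sum over pairs, and the final estimate\<close>

lemma mu_ball:
  "mu q (ball x R) = (\<Sum>d\<in>totatives q. indicator (ball (inverse_point q d) R) x) / real (card (totatives q))"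
proof -
  \<comment> \<open>Symmetry of the distance swaps centre and point, turning the count into a sum of
    indicators of fixed balls.\<close>
  have "(\<Sum>d\<in>totatives q. indicator (ball (inverse_point q d) R) x) =
      (\<Sum>d\<in>{d \<in> totatives q. inverse_point q d \<in> ball x R}. 1::real)"
    by (intro sum.mono_neutral_cong_right) (auto simp: dist_commute split: split_indicator)
  then show ?thesis
    by (simp add: mu_def totient_def inverse_point_def)
qed

lemma Var_mu_eq:
  assumes "q > 0"
  shows "Var_mu q R = torus_ball_vol R / totient q - (torus_ball_vol R)\<^sup>2 +
    (\<Sum>(d, e)\<in>{p \<in> totatives q \<times> totatives q. fst p \<noteq> snd p}.
      measure torus_measure (ball (inverse_point q d) R \<inter> ball (inverse_point q e) R)) / (real (totient q))\<^sup>2"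
  unfolding Var_mu_def mu_ball totient_def using assms
  by (intro prob_space.second_moment_indicator_average prob_space_torus_measure)
    (auto simp: inverse_point_def measure_torus_ball)

theorem theorem1p4:
  shows "\<exists>C::real. C > 0 \<and>
    (\<forall>(q::nat) (R::real). prime q \<longrightarrow> 0 < R \<longrightarrow> R < 1 / 2 \<longrightarrow>
      \<bar>Var_mu q R - torus_ball_vol R / real (totient q)\<bar> \<le> C * R ^ 4 * (ln (real q))\<^sup>2)"
proof (intro exI conjI allI impI)
  \<comment> \<open>The constant is \<open>512 * 4\<close>: 512 bounds the error without the
    logarithm, and 4 compensates for \<open>(ln q)\<^sup>2\<close> being possibly as small as the
    bound 1/4 used below.\<close>
  show "(2048 :: real) > 0" by simp
  fix q :: nat and R :: real
  assume q: "prime q" and R: "0 < R" "R < 1 / 2"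
  interpret T: prob_space torus_measure by (rule prob_space_torus_measure)
  let ?v = "torus_ball_vol R" and ?D = "{p \<in> totatives q \<times> totatives q. fst p \<noteq> snd p}"
  let ?B = "\<lambda>d. ball (inverse_point q d) R"
  define S where "S = (\<Sum>(d, e)\<in>?D. measure torus_measure (?B d \<inter> ?B e))"
  have q2: "q \<ge> 2" using q by (rule prime_ge_2_nat)
  \<comment> \<open>For a prime the totient is \<open>q - 1\<close>. This lower bound cancels the
    \<open>q\<^sup>2\<close> of the pair count.\<close>
  have N: "real (totient q) \<ge> real q / 2"
    using q q2 by (simp add: totient_prime)
  have v: "0 \<le> ?v" "?v \<le> 4 * R\<^sup>2"
    using torus_ball_vol_le[of R] R by (simp_all add: torus_ball_vol_def)
  have S0: "S \<ge> 0" unfolding S_def by (intro sum_nonneg) auto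
  have "S = (\<Sum>(d, e)\<in>close_pairs q (2 * R). measure torus_measure (?B d \<inter> ?B e))"
    unfolding S_def
  proof (rule sum.mono_neutral_right)
    show "\<forall>p\<in>?D - close_pairs q (2 * R). (case p of (d, e) \<Rightarrow> measure torus_measure (?B d \<inter> ?B e)) = 0"
    proof clarify
      fix d e assume "fst (d, e) \<noteq> snd (d, e)" "d \<in> totatives q" "e \<in> totatives q"
        "(d, e) \<notin> close_pairs q (2 * R)"
      then have "dist (inverse_point q d) (inverse_point q e) \<ge> R + R"
        by (simp add: close_pairs_def)
      then have "?B d \<inter> ?B e = {}"
        by (rule disjoint_ballI)
      then show "measure torus_measure (?B d \<inter> ?B e) = 0" by simp
    qed
  qed (auto simp: close_pairs_def)
  also have "\<dots> \<le> (\<Sum>p\<in>close_pairs q (2 * R). 4 * R\<^sup>2)"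
  proof (rule sum_mono, clarify)
    fix d e
    have "measure torus_measure (?B d \<inter> ?B e) \<le> measure torus_measure (?B d)"
      by (intro T.finite_measure_mono) auto
    also have "\<dots> \<le> 4 * R\<^sup>2"
      using v by (simp add: inverse_point_def measure_torus_ball)
    finally show "measure torus_measure (?B d \<inter> ?B e) \<le> 4 * R\<^sup>2" .
  qed
  also have "\<dots> \<le> 8 * (2 * R * real q)\<^sup>2 * (4 * R\<^sup>2)"
    using card_close_pairs_le[OF q, of "2 * R"] R by (simp add: mult_right_mono)
  \<comment> \<open>The factor is 8 * 4 * 4 = 128, and another 4 comes from writing \<open>q\<close>
    as twice \<open>q / 2\<close>.\<close>
  also have "\<dots> = 512 * R ^ 4 * (real q / 2)\<^sup>2"
    by (simp add: power2_eq_square power4_eq_xxxx)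
  also have "\<dots> \<le> 512 * R ^ 4 * (real (totient q))\<^sup>2"
    using N R by (intro mult_left_mono power_mono) auto
  finally have S1: "S / (real (totient q))\<^sup>2 \<le> 512 * R ^ 4"
    using q2 by (subst pos_divide_le_eq) auto
  have v2: "?v\<^sup>2 \<le> 512 * R ^ 4"
  proof -
    have "?v\<^sup>2 \<le> (4 * R\<^sup>2)\<^sup>2" using v by (intro power_mono) simp_all
    also have "\<dots> = 16 * R ^ 4" by (simp add: power_mult_distrib flip: power_mult)
    also have "\<dots> \<le> 512 * R ^ 4" by simp
    finally show ?thesis .
  qed
  \<comment> \<open>An absolute lower bound for the logarithm lets the factor
    \<open>(ln q)\<^sup>2\<close> be inserted at the cost of a constant.\<close>
  have "1 / 2 \<le> ln (2::real)"
    using exp_half_le2 by (subst ln_ge_iff) auto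
  also have "\<dots> \<le> ln (real q)" using q2 by simp
  finally have "(1 / 2)\<^sup>2 \<le> (ln (real q))\<^sup>2" by (intro power_mono) auto
  then have ln: "512 * R ^ 4 \<le> 2048 * R ^ 4 * (ln (real q))\<^sup>2"
    using mult_left_mono[of "(1 / 2)\<^sup>2" "(ln (real q))\<^sup>2" "2048 * R ^ 4"] by (simp add: power2_eq_square)
  \<comment> \<open>The deviation is a difference of two nonnegative terms, so a common bound for
    both also bounds its absolute value.\<close>
  have "Var_mu q R - ?v / real (totient q) = S / (real (totient q))\<^sup>2 - ?v\<^sup>2"
    using Var_mu_eq[of q R] q2 by (simp add: S_def)
  moreover have "0 \<le> S / (real (totient q))\<^sup>2" using S0 by simp
  moreover have "0 \<le> ?v\<^sup>2" by simp
  ultimately have "\<bar>Var_mu q R - ?v / real (totient q)\<bar> \<le> 512 * R ^ 4"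
    using S1 v2 by linarith
  with ln show "\<bar>Var_mu q R - ?v / real (totient q)\<bar> \<le> 2048 * R ^ 4 * (ln (real q))\<^sup>2" by linarith
qed

end
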